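(* Fix $n\geq 2$. Let $V$ be an irreducible component of $V_n$ or of $W_n$. Then $V\subset\{z=0\}$ if and only if $V\cap\{z=0\}\neq\emptyset$. The same result holds more generally when $V$ is a connected component of $V_n$ or of $W_n$.
   Context: For $u,v\in\mathbb{C}^n$, $u*v=(u_1v_1,\ldots,u_nv_n)$ is the coordinatewise product, $u^k$ is the coordinatewise $k$-th power, and $\Delta[u]$ is the diagonal $n\times n$ matrix with $(i,i)$ entry $u_i$. $\mathcal{M}_n$ is the set of complex $n\times n$ matrices. The following are algebraic subvarieties of the affine space $\mathbb{C}^n\times\mathbb{C}^n\times\mathcal{M}_n$: $$V_n=\{(y,z,A)\in\mathbb{C}^n\times\mathbb{C}^n\times\mathcal{M}_n:\ \det(Id+\Delta[(sz+ty)^2].A)=1\ \forall s,t\in\mathbb{C},\ z+A.(z^3+z*y^2)=0\},$$ $$W_n=\{(y,z,A)\in\mathbb{C}^n\times\mathbb{C}^n\times\mathcal{M}_n:\ \det(Id+\Delta[(sz+tA.y)^2].A)=1\ \forall s,t\in\mathbb{C},\ z+A.(z^3+z*(A.y)^2)=0\}.$$ $\{z=0\}$ denotes the set of triples $(y,z,A)$ with $z=0$. *)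

theory Defs
  imports "HOL-Analysis.Analysis"
begin

text \<open>The affine space \<open>\<complex>\<^sup>n \<times> \<complex>\<^sup>n \<times> \<M>\<^sub>n\<close>, with \<open>n = CARD('n)\<close>.\<close>

type_synonym 'n triple = "(complex ^ 'n) \<times> (complex ^ 'n) \<times> (complex ^ 'n ^ 'n)"

text \<open>Polynomials in the \<open>2 n + n\<^sup>2\<close> coordinates, represented by the functions they induce
  (faithfully so, as \<open>\<complex>\<close> is infinite).\<close>

inductive_set polynomial_functions :: "('n::finite triple \<Rightarrow> complex) set" where
  const: "(\<lambda>_. c) \<in> polynomial_functions"
| coord_y: "(\<lambda>(y, z, A). y $ i) \<in> polynomial_functions"
| coord_z: "(\<lambda>(y, z, A). z $ i) \<in> polynomial_functions"
| coord_A: "(\<lambda>(y, z, A). A $ i $ j) \<in> polynomial_functions"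
| add: "p \<in> polynomial_functions \<Longrightarrow> q \<in> polynomial_functions \<Longrightarrow> (\<lambda>x. p x + q x) \<in> polynomial_functions"
| mult: "p \<in> polynomial_functions \<Longrightarrow> q \<in> polynomial_functions \<Longrightarrow> (\<lambda>x. p x * q x) \<in> polynomial_functions"

definition zero_locus :: "('n::finite triple \<Rightarrow> complex) set \<Rightarrow> 'n triple set" where
  "zero_locus P = {x. \<forall>p\<in>P. p x = 0}"

definition zariski :: "'n::finite triple topology" where
  "zariski = topology (\<lambda>U. \<exists>P\<subseteq>polynomial_functions. - U = zero_locus P)"

text \<open>The function \<open>topology\<close> is only meaningful on families of sets satisfying \<open>istopology\<close>.\<close>

lemma istopology_zariski:
  "istopology (\<lambda>U::'n::finite triple set. \<exists>P\<subseteq>polynomial_functions. - U = zero_locus P)"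
  unfolding istopology_def
proof (intro conjI allI impI)
  fix S T :: "'n triple set"
  assume "\<exists>P\<subseteq>polynomial_functions. - S = zero_locus P"
    and "\<exists>P\<subseteq>polynomial_functions. - T = zero_locus P"
  then obtain P Q where P: "P \<subseteq> polynomial_functions" "- S = zero_locus P"
    and Q: "Q \<subseteq> polynomial_functions" "- T = zero_locus Q"
    by blast
  let ?R = "{\<lambda>x. p x * q x | p q. p \<in> P \<and> q \<in> Q}"
  have R: "?R \<subseteq> polynomial_functions"
  proof
    fix r assume "r \<in> ?R"
    then obtain p q where "r = (\<lambda>x. p x * q x)" "p \<in> P" "q \<in> Q"
      by blast
    then show "r \<in> polynomial_functions"
      using P(1) Q(1) polynomial_functions.mult[of p q] by (simp add: subset_iff)
  qed
  have "zero_locus ?R = zero_locus P \<union> zero_locus Q"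
  proof (intro equalityI subsetI)
    fix x assume x: "x \<in> zero_locus ?R"
    have pq: "p x = 0 \<or> q x = 0" if "p \<in> P" "q \<in> Q" for p q
    proof -
      have "(\<lambda>x. p x * q x) \<in> ?R"
        using that by blast
      then have "p x * q x = 0"
        using x unfolding zero_locus_def by (metis (mono_tags, lifting) mem_Collect_eq)
      then show ?thesis
        by simp
    qed
    show "x \<in> zero_locus P \<union> zero_locus Q"
    proof (cases "\<forall>p\<in>P. p x = 0")
      case False
      then show ?thesis
        using pq unfolding zero_locus_def by blast
    qed (simp add: zero_locus_def)
  next
    fix x assume "x \<in> zero_locus P \<union> zero_locus Q"
    then show "x \<in> zero_locus ?R"
      unfolding zero_locus_def by force
  qed
  then have "- (S \<inter> T) = zero_locus ?R"
    by (simp only: Compl_Int P(2) Q(2))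
  with R show "\<exists>P\<subseteq>polynomial_functions. - (S \<inter> T) = zero_locus P"
    by (intro exI[of _ ?R] conjI)
next
  fix \<K> :: "'n triple set set"
  assume "\<forall>K\<in>\<K>. \<exists>P\<subseteq>polynomial_functions. - K = zero_locus P"
  then obtain F where F: "\<And>K. K \<in> \<K> \<Longrightarrow> F K \<subseteq> polynomial_functions \<and> - K = zero_locus (F K)"
    by metis
  have "- \<Union>\<K> = (\<Inter>K\<in>\<K>. zero_locus (F K))"
    using F by blast
  also have "\<dots> = zero_locus (\<Union>K\<in>\<K>. F K)"
    unfolding zero_locus_def by blast
  finally have "- \<Union>\<K> = zero_locus (\<Union>K\<in>\<K>. F K)" .
  moreover have "(\<Union>K\<in>\<K>. F K) \<subseteq> polynomial_functions"
    using F by (simp add: UN_subset_iff)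
  ultimately show "\<exists>P\<subseteq>polynomial_functions. - \<Union>\<K> = zero_locus P"
    by (intro exI[of _ "\<Union>K\<in>\<K>. F K"] conjI)
qed

lemma openin_zariski:
  "openin zariski U \<longleftrightarrow> (\<exists>P\<subseteq>polynomial_functions. - U = zero_locus P)"
  by (simp add: zariski_def istopology_zariski)

lemma topspace_zariski [simp]: "topspace (zariski :: 'n::finite triple topology) = UNIV"
proof -
  have "zero_locus {\<lambda>_::'n triple. 1} = {}"
    by (simp add: zero_locus_def)
  then have "openin zariski (UNIV :: 'n triple set)"
    unfolding openin_zariski using polynomial_functions.const[of 1]
    by (intro exI[of _ "{\<lambda>_. 1}"]) simp
  then show ?thesis
    using openin_subset by blast
qed

lemma closedin_zariski:
  "closedin zariski C \<longleftrightarrow> (\<exists>P\<subseteq>polynomial_functions. C = zero_locus P)"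
  by (simp add: closedin_def openin_zariski Compl_eq_Diff_UNIV[symmetric])

definition irreducible_in :: "'a topology \<Rightarrow> 'a set \<Rightarrow> bool" where
  "irreducible_in X S \<longleftrightarrow> S \<subseteq> topspace X \<and> S \<noteq> {} \<and>
     (\<forall>C D. closedin X C \<and> closedin X D \<and> S \<subseteq> C \<union> D \<longrightarrow> S \<subseteq> C \<or> S \<subseteq> D)"

definition irreducible_components_of :: "'a topology \<Rightarrow> 'a set set" where
  "irreducible_components_of X =
     {S. irreducible_in X S \<and> (\<forall>T. irreducible_in X T \<and> S \<subseteq> T \<longrightarrow> T = S)}"

definition diag_matrix :: "complex ^ 'n \<Rightarrow> complex ^ 'n ^ 'n" where
  "diag_matrix u = (\<chi> i j. if i = j then u $ i else 0)"

text \<open>Multiplication \<open>*\<close> and powers of vectors in \<open>complex ^ 'n\<close> are coordinatewise.\<close>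

definition V_var :: "'n::finite triple set" where
  "V_var = {(y, z, A).
     (\<forall>s t. det (mat 1 + diag_matrix ((s *s z + t *s y) ^ 2) ** A) = 1) \<and>
     z + A *v (z ^ 3 + z * y ^ 2) = 0}"

definition W_var :: "'n::finite triple set" where
  "W_var = {(y, z, A).
     (\<forall>s t. det (mat 1 + diag_matrix ((s *s z + t *s (A *v y)) ^ 2) ** A) = 1) \<and>
     z + A *v (z ^ 3 + z * (A *v y) ^ 2) = 0}"

definition z_zero :: "'n::finite triple set" where
  "z_zero = {(y, z, A). z = 0}"

end

theory Submission
  imports Defs
begin

text \<open>Write \<open>u = y\<close> for \<open>V_var\<close> and \<open>u = A y\<close> for \<open>W_var\<close>, and let \<open>D\<close> be the diagonal
  matrix of \<open>z\<^sup>2 + u\<^sup>2\<close>. The vector equation reads \<open>(1 + A D) z = 0\<close>, whence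
  \<open>(1 + D A) (D z) = 0\<close>; so \<open>det (1 + D A)\<close> vanishes as soon as \<open>z \<noteq> 0\<close>. For \<open>z = 0\<close> the
  determinant condition at \<open>t = 1\<close> says that it is \<open>1\<close>. Therefore \<open>z = 0\<close> cuts out a subset that
  is both open and closed, and irreducible or connected sets lie on one side of it.\<close>

lemma polynomial_functions_sum:
  assumes "finite I" "\<And>i. i \<in> I \<Longrightarrow> f i \<in> polynomial_functions"
  shows "(\<lambda>x. \<Sum>i\<in>I. f i x) \<in> polynomial_functions"
  using assms by (induction I) (auto intro: polynomial_functions.intros)

lemma polynomial_functions_prod:
  assumes "finite I" "\<And>i. i \<in> I \<Longrightarrow> f i \<in> polynomial_functions"
  shows "(\<lambda>x. \<Prod>i\<in>I. f i x) \<in> polynomial_functions"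
  using assms by (induction I) (auto intro: polynomial_functions.intros)

text \<open>By the Leibniz formula, a determinant is a signed sum over permutations of products of
  entries.\<close>

lemma polynomial_functions_det:
  fixes M :: "'n::finite triple \<Rightarrow> complex ^ 'm ^ 'm::finite"
  assumes "\<And>i j. (\<lambda>x. M x $ i $ j) \<in> polynomial_functions"
  shows "(\<lambda>x. det (M x)) \<in> polynomial_functions"
  unfolding det_def using assms
  by (intro polynomial_functions_sum polynomial_functions_prod polynomial_functions.mult
      polynomial_functions.const) simp_all

text \<open>The coordinate generators, rewritten with projections to match goals in which
  \<open>case_prod_unfold\<close> has removed the pattern abstractions.\<close>

lemma polynomial_functions_coords:
  "(\<lambda>x. fst x $ i) \<in> polynomial_functions"
  "(\<lambda>x. fst (snd x) $ i) \<in> polynomial_functions"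
  "(\<lambda>x. snd (snd x) $ i $ j) \<in> polynomial_functions"
  using polynomial_functions.coord_y polynomial_functions.coord_z polynomial_functions.coord_A
  by (simp_all add: case_prod_unfold)

lemma diag_matrix_mult_component: "(diag_matrix u ** A) $ i $ j = u $ i * A $ i $ j"
  by (simp add: diag_matrix_def matrix_matrix_mult_def if_distrib[of "\<lambda>x. x * _"] cong: if_cong)

lemma diag_matrix_mult_vector: "diag_matrix u *v x = u * x"
  by (simp add: vec_eq_iff diag_matrix_def matrix_vector_mult_def if_distrib[of "\<lambda>x. x * _"]
      cong: if_cong)

text \<open>Each entry of the matrix is a constant plus (z_i^2 + u_i^2) A_ij, hence polynomial. The
  zero locus of this function will be the closed set that complements \<open>z_zero\<close> inside
  the variety.\<close>

lemma polynomial_functions_det_diag: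
  fixes u :: "'n::finite triple \<Rightarrow> complex ^ 'n"
  assumes "\<And>i. (\<lambda>x. u x $ i) \<in> polynomial_functions"
  shows "(\<lambda>(y, z, A). det (mat 1 + diag_matrix (z ^ 2 + u (y, z, A) ^ 2) ** A))
    \<in> polynomial_functions"
  unfolding case_prod_unfold prod.collapse using assms
  by (intro polynomial_functions_det)
    (auto simp: diag_matrix_mult_component mat_def power2_eq_square
      intro!: polynomial_functions.intros polynomial_functions_coords)

lemma det_eq_0_if_kernel:
  fixes z u :: "complex ^ 'n::finite"
  assumes "z + A *v (z ^ 3 + z * u ^ 2) = 0" "z \<noteq> 0"
  shows "det (mat 1 + diag_matrix (z ^ 2 + u ^ 2) ** A) = 0"
proof -
  define D where "D = diag_matrix (z ^ 2 + u ^ 2)"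
  have Dz: "D *v z = z ^ 3 + z * u ^ 2"
    by (simp add: D_def diag_matrix_mult_vector power2_eq_square power3_eq_cube algebra_simps)
  \<comment> \<open>The push-through identity (1 + D A) D = D (1 + A D), applied to z.\<close>
  have "(mat 1 + D ** A) *v (D *v z) = D *v (z + A *v (D *v z))"
    by (simp only: matrix_vector_mult_add_rdistrib matrix_vector_right_distrib
        matrix_vector_mul_lid matrix_vector_mul_assoc[of D A, symmetric])
  also have "\<dots> = 0"
    using assms(1) by (simp add: Dz)
  finally have "(mat 1 + D ** A) *v (D *v z) = 0" .
  \<comment> \<open>If D z were 0, the equation z + A (D z) = 0 would force z = 0.\<close>
  moreover have "D *v z \<noteq> 0"
    using assms by (auto simp: Dz)
  ultimately have "\<not> invertible (mat 1 + D ** A)"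
    by (metis invertible_def matrix_vector_mul_assoc matrix_vector_mul_lid matrix_vector_mult_0_right)
  then show ?thesis
    by (simp add: D_def invertible_det_nz)
qed

lemma closedin_zero_locus: "P \<subseteq> polynomial_functions \<Longrightarrow> closedin zariski (zero_locus P)"
  by (auto simp: closedin_zariski)

lemma closedin_z_zero: "closedin zariski (z_zero :: 'n::finite triple set)"
proof -
  have "(z_zero :: 'n triple set) = zero_locus (range (\<lambda>i (y, z, A). z $ i))"
    by (auto simp: z_zero_def zero_locus_def vec_eq_iff)
  moreover have "range (\<lambda>i (y, z, A). z $ i) \<subseteq> (polynomial_functions :: ('n triple \<Rightarrow> complex) set)"
    using polynomial_functions.coord_z by blast
  ultimately show ?thesis
    by (metis closedin_zero_locus)
qed

text \<open>Components are taken in the subspace \<open>S\<close>, so \<open>C\<close> and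
  \<open>D\<close> are replaced by their closed traces on \<open>S\<close>, which cover
  \<open>S\<close> and are disjoint. Neither an irreducible nor a connected set can be split between
  them.\<close>

lemma separated_components:
  assumes C: "closedin X C" and D: "closedin X D" and "S \<subseteq> C \<union> D" "S \<inter> C \<inter> D = {}"
    and V: "V \<in> irreducible_components_of (subtopology X S) \<union>
      connected_components_of (subtopology X S)"
  shows "V \<subseteq> C \<longleftrightarrow> V \<inter> C \<noteq> {}"
proof -
  have cl: "closedin (subtopology X S) (S \<inter> C)" "closedin (subtopology X S) (S \<inter> D)"
    using C D by (auto simp: closedin_subtopology)
  have V_sub: "V \<noteq> {}" "V \<subseteq> S"
    using V nonempty_connected_components_of[of V "subtopology X S"]
      connected_components_of_subset[of V "subtopology X S"]
    by (auto simp: irreducible_components_of_def irreducible_in_def)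
  have "V \<subseteq> S \<inter> C \<or> V \<subseteq> S \<inter> D"
    using V
  proof
    assume "V \<in> irreducible_components_of (subtopology X S)"
    then have "irreducible_in (subtopology X S) V"
      by (simp add: irreducible_components_of_def)
    moreover have "V \<subseteq> S \<inter> C \<union> S \<inter> D"
      using V_sub \<open>S \<subseteq> C \<union> D\<close> by blast
    ultimately show ?thesis
      using cl unfolding irreducible_in_def by metis
  next
    assume "V \<in> connected_components_of (subtopology X S)"
    then have "connectedin (subtopology X S) V"
      by (rule connectedin_connected_components_of)
    then have "\<not> (V \<subseteq> S \<inter> C \<union> S \<inter> D \<and> S \<inter> C \<inter> (S \<inter> D) \<inter> V = {} \<and>
        S \<inter> C \<inter> V \<noteq> {} \<and> S \<inter> D \<inter> V \<noteq> {})"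
      using cl unfolding connectedin_closedin by metis
    then show ?thesis
      using V_sub assms(3,4) by blast
  qed
  \<comment> \<open>Inside the trace of \<open>C\<close>, the nonempty \<open>V\<close> meets
    \<open>C\<close>; inside the trace of \<open>D\<close>, it misses \<open>C\<close> and, being
    nonempty, is not contained in it.\<close>
  then show ?thesis
    using V_sub assms(4) by blast
qed

text \<open>The map \<open>u\<close> lets one argument serve both varieties: it becomes y for
  \<open>V_var\<close> and A y for \<open>W_var\<close>.\<close>

lemma components_z_zero:
  fixes u :: "'n::finite triple \<Rightarrow> complex ^ 'n" and S :: "'n triple set"
  assumes "\<And>i. (\<lambda>x. u x $ i) \<in> polynomial_functions"
    and kernel: "\<And>y z A. (y, z, A) \<in> S \<Longrightarrow> z + A *v (z ^ 3 + z * u (y, z, A) ^ 2) = 0"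
    and det: "\<And>y z A. (y, z, A) \<in> S \<Longrightarrow> z = 0 \<Longrightarrow>
      det (mat 1 + diag_matrix (u (y, z, A) ^ 2) ** A) = 1"
    and V: "V \<in> irreducible_components_of (subtopology zariski S) \<union>
      connected_components_of (subtopology zariski S)"
  shows "V \<subseteq> z_zero \<longleftrightarrow> V \<inter> z_zero \<noteq> {}"
proof -
  \<comment> \<open>On \<open>S\<close> this determinant is 0 where z is nonzero, by the kernel
    vector, and 1 where z = 0, so \<open>D\<close> cuts out exactly the points of \<open>S\<close>
    outside \<open>z_zero\<close>.\<close>
  define D where
    "D = zero_locus {\<lambda>(y, z, A). det (mat 1 + diag_matrix (z ^ 2 + u (y, z, A) ^ 2) ** A)}"
  have "closedin zariski D"
    unfolding D_def using polynomial_functions_det_diag[OF assms(1)]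
    by (intro closedin_zero_locus) simp
  moreover have "S \<subseteq> z_zero \<union> D"
    using det_eq_0_if_kernel[OF kernel] by (auto simp: z_zero_def D_def zero_locus_def)
  moreover have "S \<inter> z_zero \<inter> D = {}"
    using det by (auto simp: z_zero_def D_def zero_locus_def power2_eq_square)
  ultimately show ?thesis
    using separated_components[OF closedin_z_zero] V by blast
qed

theorem theorem1p13:
  assumes "CARD('n::finite) \<ge> 2"
  shows "(\<forall>V \<in> irreducible_components_of (subtopology zariski (V_var :: 'n triple set)) \<union>
               irreducible_components_of (subtopology zariski (W_var :: 'n triple set)).
            V \<subseteq> z_zero \<longleftrightarrow> V \<inter> z_zero \<noteq> {}) \<and>
         (\<forall>V \<in> connected_components_of (subtopology zariski (V_var :: 'n triple set)) \<union>
               connected_components_of (subtopology zariski (W_var :: 'n triple set)).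
            V \<subseteq> z_zero \<longleftrightarrow> V \<inter> z_zero \<noteq> {})"
proof -
  have V: "V \<subseteq> z_zero \<longleftrightarrow> V \<inter> z_zero \<noteq> {}"
    if "V \<in> irreducible_components_of (subtopology zariski (V_var :: 'n triple set)) \<union>
      connected_components_of (subtopology zariski V_var)" for V
  proof (rule components_z_zero[OF _ _ _ that, where u = fst])
    fix y z :: "complex ^ 'n" and A
    assume "(y, z, A) \<in> V_var"
    \<comment> \<open>Taking s = 0 and t = 1 leaves only the square of y.\<close>
    then have "det (mat 1 + diag_matrix ((0 *s z + 1 *s y) ^ 2) ** A) = 1"
      unfolding V_var_def by blast
    then show "det (mat 1 + diag_matrix (fst (y, z, A) ^ 2) ** A) = 1"
      by simp
  qed (auto simp: V_var_def polynomial_functions_coords)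
  have W: "V \<subseteq> z_zero \<longleftrightarrow> V \<inter> z_zero \<noteq> {}"
    if "V \<in> irreducible_components_of (subtopology zariski (W_var :: 'n triple set)) \<union>
      connected_components_of (subtopology zariski W_var)" for V
  proof (rule components_z_zero[OF _ _ _ that, where u = "\<lambda>(y, z, A). A *v y"])
    show "(\<lambda>x. (case x of (y, z, A) \<Rightarrow> A *v y) $ i)
      \<in> (polynomial_functions :: ('n triple \<Rightarrow> complex) set)" for i
      \<comment> \<open>Each coordinate of A y is a sum of products A_ij y_j of coordinates.\<close>
      by (auto simp: matrix_vector_mult_def case_prod_unfold
          intro!: polynomial_functions_sum polynomial_functions.mult polynomial_functions_coords)
  next
    fix y z :: "complex ^ 'n" and A
    assume "(y, z, A) \<in> W_var"
    then have "det (mat 1 + diag_matrix ((0 *s z + 1 *s (A *v y)) ^ 2) ** A) = 1"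
      unfolding W_var_def by blast
    then show "det (mat 1 + diag_matrix ((case (y, z, A) of (y, z, A) \<Rightarrow> A *v y) ^ 2) ** A) = 1"
      by simp
  qed (auto simp: W_var_def)
  from V W show ?thesis
    by blast
qed

end
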